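(* Let $t\in\mathbb{R}$ with $t\ge 2$. Let $M(t)$ be the number of pairs $(A,B)\in\mathbb{Z}^2$ such that the Lucas sequence with parameters $(A,B)$ is non-degenerate and the root $\alpha$ of largest modulus of $x^2-Ax+B$ satisfies $|\alpha|\le t$. Then $$4t^3-10t^2-29t\le M(t)\le 4t^3-t^2+7t.$$
   Context: For integers $A,B$ the Lucas sequence is $U_0=0$, $U_1=1$, $U_n=AU_{n-1}-BU_{n-2}$ $(n\ge2)$; distinct pairs $(A,B)$ give distinct sequences. Let $\alpha,\beta$ be the roots of $x^2-Ax+B$ with $|\alpha|\ge|\beta|$. The sequence is non-degenerate if $AB\ne 0$ and $\alpha/\beta$ is not a root of unity. *)

theory Defs
  imports "HOL-Analysis.Analysis" "HOL-Computational_Algebra.Polynomial"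
begin

fun lucas_U :: "int \<Rightarrow> int \<Rightarrow> nat \<Rightarrow> int" where
  "lucas_U A B 0 = 0"
| "lucas_U A B (Suc 0) = 1"
| "lucas_U A B (Suc (Suc n)) = A * lucas_U A B (Suc n) - B * lucas_U A B n"

definition char_poly_lucas :: "int \<Rightarrow> int \<Rightarrow> complex poly" where
  "char_poly_lucas A B = [:of_int B, - of_int A, 1:]"

text \<open>The roots are taken with multiplicity, the first one having the larger modulus. If both
  moduli agree, the order is not determined; neither of the notions below depends on it.\<close>

definition lucas_roots :: "int \<Rightarrow> int \<Rightarrow> complex \<Rightarrow> complex \<Rightarrow> bool" where
  "lucas_roots A B \<alpha> \<beta> \<longleftrightarrow>
     char_poly_lucas A B = [:- \<alpha>, 1:] * [:- \<beta>, 1:] \<and> norm \<alpha> \<ge> norm \<beta>"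

definition is_root_of_unity :: "complex \<Rightarrow> bool" where
  "is_root_of_unity z \<longleftrightarrow> (\<exists>n::nat. n > 0 \<and> z ^ n = 1)"

text \<open>Non-degeneracy is a property of a sequence; its parameters are unique by
  \<open>lucas_U_inject\<close>.\<close>

definition nondegenerate :: "(nat \<Rightarrow> int) \<Rightarrow> bool" where
  "nondegenerate u \<longleftrightarrow> (\<exists>A B \<alpha> \<beta>. u = lucas_U A B \<and> lucas_roots A B \<alpha> \<beta> \<and>
     A * B \<noteq> 0 \<and> \<not> is_root_of_unity (\<alpha> / \<beta>))"

definition lucas_pairs :: "real \<Rightarrow> (int \<times> int) set" where
  "lucas_pairs t = {(A, B). nondegenerate (lucas_U A B) \<and>
     (\<exists>\<alpha> \<beta>. lucas_roots A B \<alpha> \<beta> \<and> norm \<alpha> \<le> t)}"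

definition M :: "real \<Rightarrow> nat" where
  "M t = card (lucas_pairs t)"

lemma lucas_U_inject: "lucas_U A B = lucas_U A' B' \<longleftrightarrow> A = A' \<and> B = B'"
proof
  assume eq: "lucas_U A B = lucas_U A' B'"
  have "lucas_U A B (Suc (Suc 0)) = lucas_U A' B' (Suc (Suc 0))"
    by (simp only: eq)
  then have A: "A = A'" by simp
  have "lucas_U A B (Suc (Suc (Suc 0))) = lucas_U A' B' (Suc (Suc (Suc 0)))"
    by (simp only: eq)
  with A show "A = A' \<and> B = B'" by simp
qed simp

lemma nondegenerate_lucas_U_iff:
  "nondegenerate (lucas_U A B) \<longleftrightarrow>
     (\<exists>\<alpha> \<beta>. lucas_roots A B \<alpha> \<beta> \<and> A * B \<noteq> 0 \<and> \<not> is_root_of_unity (\<alpha> / \<beta>))"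
  unfolding nondegenerate_def lucas_U_inject by blast

lemma lucas_roots_iff:
  "lucas_roots A B \<alpha> \<beta> \<longleftrightarrow> \<alpha> + \<beta> = of_int A \<and> \<alpha> * \<beta> = of_int B \<and> norm \<alpha> \<ge> norm \<beta>"
proof -
  have "- of_int A = - \<beta> - \<alpha> \<longleftrightarrow> \<alpha> + \<beta> = of_int A"
    by (auto simp: algebra_simps eq_neg_iff_add_eq_0)
  moreover have "of_int B = \<beta> * \<alpha> \<longleftrightarrow> \<alpha> * \<beta> = of_int B"
    by (auto simp: mult.commute)
  ultimately show ?thesis
    by (simp add: lucas_roots_def char_poly_lucas_def conj_ac)
qed

lemma finite_lucas_pairs: "finite (lucas_pairs t)"
proof (rule finite_subset)
  show "lucas_pairs t \<subseteq> {- \<lfloor>2 * t\<rfloor>..\<lfloor>2 * t\<rfloor>} \<times> {- \<lfloor>t * t\<rfloor>..\<lfloor>t * t\<rfloor>}"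
  proof clarify
    fix A B assume "(A, B) \<in> lucas_pairs t"
    then obtain \<alpha> \<beta> :: complex where r: "\<alpha> + \<beta> = of_int A" "\<alpha> * \<beta> = of_int B"
      and n: "norm \<beta> \<le> norm \<alpha>" "norm \<alpha> \<le> t"
      by (auto simp: lucas_pairs_def lucas_roots_iff)
    have t: "0 \<le> t" using n norm_ge_zero order_trans by blast
    have "norm (\<alpha> + \<beta>) \<le> 2 * t" using n norm_triangle_ineq[of \<alpha> \<beta>] by linarith
    then have "real_of_int \<bar>A\<bar> \<le> 2 * t" by (simp add: r)
    then have "\<bar>A\<bar> \<le> \<lfloor>2 * t\<rfloor>" by (simp only: le_floor_iff)
    moreover have "norm (\<alpha> * \<beta>) \<le> t * t"
      unfolding norm_mult using n t by (intro mult_mono) auto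
    then have "real_of_int \<bar>B\<bar> \<le> t * t" by (simp add: r)
    then have "\<bar>B\<bar> \<le> \<lfloor>t * t\<rfloor>" by (simp only: le_floor_iff)
    ultimately show "A \<in> {- \<lfloor>2 * t\<rfloor>..\<lfloor>2 * t\<rfloor>} \<and> B \<in> {- \<lfloor>t * t\<rfloor>..\<lfloor>t * t\<rfloor>}" by auto
  qed
qed simp

end

theory Submission
  imports Defs
begin

text \<open>A pair \<open>(A, B)\<close> satisfies \<open>\<bar>\<alpha>\<bar> \<le> t\<close> iff \<open>\<bar>A\<bar> \<le> 2t\<close> and \<open>\<bar>A\<bar>t - t\<^sup>2 \<le> B \<le> t\<^sup>2\<close>, which describes a
  triangle of area \<open>4t\<^sup>3\<close>; its lattice points are counted column by column. If \<open>AB \<noteq> 0\<close> and \<open>\<alpha>/\<beta>\<close>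
  is a root of unity, then \<open>\<alpha>/\<beta> + \<beta>/\<alpha> = A\<^sup>2/B - 2\<close> is rational and an algebraic integer of modulus
  at most 2, so \<open>A\<^sup>2 = kB\<close> with \<open>k \<in> {1, 2, 3, 4}\<close>. Hence every column contains at most five
  excluded points, which costs \<open>O(t)\<close> in total.\<close>

section \<open>Root quotients that are roots of unity\<close>

text \<open>With V_k = z^k + z^(-k), the recurrence V_(k+2) = V_1 V_(k+1) - V_k turns X_k = q^k V_k
  into an integer sequence with X_(k+2) = p X_(k+1) - q^2 X_k. Modulo \<open>q\<close> only the
  first term survives. The congruence starts at index 1, since X_0 = 2.\<close>

lemma power_plus_inverse_int:
  fixes z :: complex and p q :: int
  assumes "z \<noteq> 0" and w: "of_int q * (z + 1 / z) = of_int p"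
  shows "\<exists>x y :: int. of_int q ^ k * (z ^ k + 1 / z ^ k) = of_int x \<and>
    of_int q ^ Suc k * (z ^ Suc k + 1 / z ^ Suc k) = of_int y \<and> q dvd y - p ^ Suc k"
proof (induction k)
  case 0
  show ?case
    by (rule exI[of _ 2], rule exI[of _ p]) (use w in simp)
next
  case (Suc k)
  then obtain x y :: int
    where x: "of_int q ^ k * (z ^ k + 1 / z ^ k) = of_int x"
      and y: "of_int q ^ Suc k * (z ^ Suc k + 1 / z ^ Suc k) = of_int y"
      and d: "q dvd y - p ^ Suc k" by blast
  have rec: "z ^ Suc (Suc k) + 1 / z ^ Suc (Suc k)
      = (z + 1 / z) * (z ^ Suc k + 1 / z ^ Suc k) - (z ^ k + 1 / z ^ k)"
    using \<open>z \<noteq> 0\<close> by (simp add: field_simps)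
  have "of_int q ^ Suc (Suc k) * (z ^ Suc (Suc k) + 1 / z ^ Suc (Suc k))
      = (of_int q * (z + 1 / z)) * (of_int q ^ Suc k * (z ^ Suc k + 1 / z ^ Suc k))
        - of_int q ^ 2 * (of_int q ^ k * (z ^ k + 1 / z ^ k))"
    unfolding rec by (simp only: power_Suc power2_eq_square right_diff_distrib mult_ac)
  also have "\<dots> = of_int (p * y - q ^ 2 * x)"
    unfolding x y w by simp
  finally have "of_int q ^ Suc (Suc k) * (z ^ Suc (Suc k) + 1 / z ^ Suc (Suc k))
    = of_int (p * y - q ^ 2 * x)" .
  moreover have "p * y - q ^ 2 * x - p ^ Suc (Suc k) = p * (y - p ^ Suc k) - q * (q * x)"
    by (simp add: algebra_simps power2_eq_square)
  then have "q dvd p * y - q ^ 2 * x - p ^ Suc (Suc k)"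
    using d by (metis dvd_diff dvd_mult dvd_triv_left)
  ultimately show ?case using y by blast
qed

text \<open>If z^n = 1, then X_n = 2 q^n is divisible by \<open>q\<close> and congruent to p^n
  modulo \<open>q\<close>, so a reduced fraction p/q must have q = 1.\<close>

lemma root_of_unity_plus_inverse_in_Ints:
  assumes "is_root_of_unity z" and "z + 1 / z \<in> \<rat>"
  shows "z + 1 / z \<in> \<int>"
proof -
  obtain n where n: "n > 0" "z ^ n = 1"
    using assms by (auto simp: is_root_of_unity_def)
  then have "z \<noteq> 0" by (auto simp: power_0_left)
  obtain r where r: "z + 1 / z = of_rat r"
    using assms(2) by (auto elim: Rats_cases)
  obtain p q :: int where pq: "r = Fract p q" "q > 0" "coprime p q"
    by (cases r) auto
  have "of_int q * (z + 1 / z) = of_int p"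
    unfolding r pq(1) using pq(2) by (simp add: of_rat_rat)
  from power_plus_inverse_int[OF \<open>z \<noteq> 0\<close> this, of "n - 1"] n
  obtain y :: int where y: "of_int q ^ n * 2 = (of_int y :: complex)" "q dvd y - p ^ n"
    by auto
  have "y = q ^ n * 2"
    using y(1) by (metis of_int_eq_iff of_int_mult of_int_numeral of_int_power)
  then have "q dvd y" using n by simp
  then have "q dvd p ^ n" using y(2) by (simp add: dvd_diff_right_iff)
  moreover have "coprime (p ^ n) q" using pq by simp
  ultimately have "q dvd 1" using coprime_common_divisor dvd_refl by blast
  then have "q = 1" using pq(2) by simp
  then show ?thesis
    unfolding r pq(1) by (simp add: of_rat_rat)
qed

text \<open>For z = \<open>\<alpha> / \<beta>\<close>, A^2/B = z + 1/z + 2. Here z + 1/z is an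
  integer m, and |m| <= 2 because |z| = 1, so k = m + 2 works.\<close>

lemma degenerate_imp:
  assumes roots: "lucas_roots A B \<alpha> \<beta>" and "B \<noteq> 0" and u: "is_root_of_unity (\<alpha> / \<beta>)"
  shows "\<exists>k \<in> {0..4}. A ^ 2 = k * B"
proof -
  define z where "z = \<alpha> / \<beta>"
  have s: "\<alpha> + \<beta> = of_int A" "\<alpha> * \<beta> = of_int B"
    using roots by (auto simp: lucas_roots_iff)
  then have nz: "\<alpha> \<noteq> 0" "\<beta> \<noteq> 0" using \<open>B \<noteq> 0\<close> by auto
  have "(z + 1 / z + 2) * (\<alpha> * \<beta>) = (\<alpha> + \<beta>) ^ 2"
    unfolding z_def using nz by (simp add: field_simps power2_eq_square)
  then have e: "(z + 1 / z + 2) * of_int B = of_int A ^ 2"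
    unfolding s .
  then have "z + 1 / z = of_int A ^ 2 / of_int B - 2"
    using \<open>B \<noteq> 0\<close> by (simp add: field_simps)
  then have "z + 1 / z \<in> \<rat>" by simp
  then have "z + 1 / z \<in> \<int>"
    using root_of_unity_plus_inverse_in_Ints u z_def by blast
  then obtain m where m: "z + 1 / z = of_int m" by (auto elim: Ints_cases)
  obtain n where n: "n > 0" "z ^ n = 1" using u by (auto simp: is_root_of_unity_def z_def)
  then have "norm z ^ n = 1" by (metis norm_one norm_power)
  then have "norm z = 1"
    using n(1) power_eq_imp_eq_base[of "norm z" n 1] by simp
  then have "norm (z + 1 / z) \<le> 2"
    using norm_triangle_ineq[of z "1 / z"] by (simp add: norm_divide)
  then have "\<bar>m\<bar> \<le> 2" unfolding m by simp
  moreover have "of_int A ^ 2 = (of_int ((m + 2) * B) :: complex)"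
    using e unfolding m by simp
  then have "A ^ 2 = (m + 2) * B" by (metis of_int_eq_iff of_int_power)
  ultimately show ?thesis by (intro bexI[of _ "m + 2"]) auto
qed

section \<open>Pairs with both roots in the disc of radius t\<close>

text \<open>This is the stability triangle of a real monic quadratic, scaled to radius
  \<open>t\<close>, without the degenerate column A = 0. Points with B = 0 remain.\<close>

definition root_triangle :: "real \<Rightarrow> (int \<times> int) set" where
  "root_triangle t = (SIGMA A : {-\<lfloor>2 * t\<rfloor>..\<lfloor>2 * t\<rfloor>} - {0}. {\<lceil>\<bar>A\<bar> * t - t ^ 2\<rceil>..\<lfloor>t ^ 2\<rfloor>})"

lemma mem_root_triangle:
  "(A, B) \<in> root_triangle t \<longleftrightarrow>
     A \<noteq> 0 \<and> \<bar>A\<bar> \<le> 2 * t \<and> \<bar>A\<bar> * t - t ^ 2 \<le> B \<and> B \<le> t ^ 2"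
proof -
  have "A \<in> {-\<lfloor>2 * t\<rfloor>..\<lfloor>2 * t\<rfloor>} \<longleftrightarrow> \<bar>A\<bar> \<le> \<lfloor>2 * t\<rfloor>" by auto
  also have "\<dots> \<longleftrightarrow> \<bar>A\<bar> \<le> 2 * t" by (simp only: le_floor_iff)
  finally show ?thesis
    by (auto simp: root_triangle_def le_floor_iff ceiling_le_iff)
qed

lemma lucas_pairs_subset: "lucas_pairs t \<subseteq> root_triangle t"
proof clarify
  fix A B assume AB: "(A, B) \<in> lucas_pairs t"
  then have "A \<noteq> 0" by (auto simp: lucas_pairs_def nondegenerate_lucas_U_iff)
  obtain \<alpha> \<beta> :: complex where s: "\<alpha> + \<beta> = of_int A" "\<alpha> * \<beta> = of_int B"
    and n: "norm \<beta> \<le> norm \<alpha>" "norm \<alpha> \<le> t"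
    using AB by (auto simp: lucas_pairs_def lucas_roots_iff)
  have t: "0 \<le> t" using n norm_ge_zero order_trans by blast
  have "norm (\<alpha> + \<beta>) \<le> 2 * t" using n norm_triangle_ineq[of \<alpha> \<beta>] by linarith
  then have A: "real_of_int \<bar>A\<bar> \<le> 2 * t" by (simp add: s)
  have "norm (\<alpha> * \<beta>) \<le> t * t"
    unfolding norm_mult using n t by (intro mult_mono) auto
  then have B: "B \<le> t ^ 2" by (simp add: s power2_eq_square)
  have "\<bar>A\<bar> * t - t ^ 2 \<le> B"
  proof (cases "A ^ 2 < 4 * B")
    case True
    \<comment> \<open>As a function of |A|, the parabola A^2/4 lies above its tangent |A|t - t^2 at
      |A| = 2t.\<close>
    have "0 \<le> (\<bar>real_of_int A\<bar> - 2 * t) ^ 2" by simp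
    then have "\<bar>A\<bar> * t - t ^ 2 \<le> real_of_int (A ^ 2) / 4"
      by (simp add: power2_eq_square algebra_simps)
    also have "\<dots> \<le> B" using True by linarith
    finally show ?thesis .
  next
    case False
    have "(\<alpha> - \<beta>) ^ 2 = (\<alpha> + \<beta>) ^ 2 - 4 * (\<alpha> * \<beta>)"
      by (simp add: power2_eq_square algebra_simps)
    also have "\<dots> = of_real (real_of_int (A ^ 2 - 4 * B))" unfolding s by simp
    also have "\<dots> = of_real (sqrt (real_of_int (A ^ 2 - 4 * B))) ^ 2"
    proof -
      have "0 \<le> real_of_int (A ^ 2 - 4 * B)" using False by (simp only: of_int_0_le_iff)
      then show ?thesis by (simp only: of_real_power [symmetric] real_sqrt_pow2)
    qed
    \<comment> \<open>A complex number whose square is the square of a real r is r or -r.\<close>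
    finally have "\<alpha> - \<beta> \<in> \<real>"
      by (auto simp: power2_eq_iff)
    moreover have "\<alpha> = ((\<alpha> + \<beta>) + (\<alpha> - \<beta>)) / 2" "\<beta> = ((\<alpha> + \<beta>) - (\<alpha> - \<beta>)) / 2" by auto
    moreover have "\<alpha> + \<beta> \<in> \<real>" unfolding s by simp
    ultimately have "\<alpha> \<in> \<real>" "\<beta> \<in> \<real>"
      by (metis Reals_add Reals_diff Reals_divide Reals_numeral)+
    then obtain x y where xy: "\<alpha> = of_real x" "\<beta> = of_real y" by (auto elim!: Reals_cases)
    have "of_real (x + y) = (of_real (of_int A) :: complex)"
      "of_real (x * y) = (of_real (of_int B) :: complex)"
      using s unfolding xy by simp_all
    then have xyAB: "x + y = A" "x * y = B" by (simp_all only: of_real_eq_iff)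
    have "\<bar>x\<bar> \<le> t" "\<bar>y\<bar> \<le> t" using n unfolding xy by auto
    \<comment> \<open>These products are the values of x^2 - Ax + B at t and -t.\<close>
    then have "0 \<le> (t - x) * (t - y)" "0 \<le> (t + x) * (t + y)"
      by (auto intro!: mult_nonneg_nonneg)
    then have "0 \<le> t ^ 2 - t * (x + y) + x * y" "0 \<le> t ^ 2 + t * (x + y) + x * y"
      by (simp_all add: algebra_simps power2_eq_square)
    then show ?thesis unfolding xyAB by (auto simp: abs_if algebra_simps)
  qed
  with \<open>A \<noteq> 0\<close> A B show "(A, B) \<in> root_triangle t" by (simp add: mem_root_triangle)
qed

text \<open>Real roots have modulus at most (|A| + sqrt D)/2, and the lower bound on
  \<open>B\<close> says exactly that D <= (2t - |A|)^2. Non-real roots are conjugate, so their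
  squared modulus is B <= t^2.\<close>

lemma root_triangle_imp_lucas_roots:
  assumes "(A, B) \<in> root_triangle t" and t: "0 \<le> t"
  shows "\<exists>\<alpha> \<beta>. lucas_roots A B \<alpha> \<beta> \<and> norm \<alpha> \<le> t"
proof -
  define D where "D = real_of_int (A ^ 2 - 4 * B)"
  define s where "s = csqrt (of_real D)"
  define \<alpha> \<beta> where "\<alpha> = (of_int A + s) / 2" and "\<beta> = (of_int A - s) / 2"
  have AB: "\<bar>A\<bar> \<le> 2 * t" "\<bar>A\<bar> * t - t ^ 2 \<le> B" "B \<le> t ^ 2"
    using assms by (auto simp: mem_root_triangle)
  have "s ^ 2 = of_int (A ^ 2 - 4 * B)" by (simp add: s_def D_def)
  then have sum: "\<alpha> + \<beta> = of_int A" and prod: "\<alpha> * \<beta> = of_int B"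
    by (auto simp: \<alpha>_def \<beta>_def field_simps power2_eq_square)
  have "norm \<alpha> \<le> t \<and> norm \<beta> \<le> t"
  proof (cases "0 \<le> D")
    case True
    have "D \<le> (2 * t - \<bar>A\<bar>) ^ 2"
      using AB(2) by (simp add: D_def power2_eq_square algebra_simps)
    then have "sqrt D \<le> 2 * t - \<bar>A\<bar>"
      using AB(1) by (intro real_le_lsqrt) auto
    moreover have "norm s = sqrt D" using True by (simp add: s_def)
    moreover have "norm (of_int A + s) \<le> \<bar>A\<bar> + norm s" "norm (of_int A - s) \<le> \<bar>A\<bar> + norm s"
      using norm_triangle_ineq[of "of_int A" s] norm_triangle_ineq4[of "of_int A" s] by auto
    ultimately show ?thesis by (auto simp: \<alpha>_def \<beta>_def norm_divide)
  next
    case False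
    then have "s = \<i> * of_real (sqrt (- D))"
      by (simp add: s_def csqrt_of_real_nonpos)
    then have "\<beta> = cnj \<alpha>" by (simp add: \<alpha>_def \<beta>_def)
    then have "norm \<beta> = norm \<alpha>" by simp
    moreover have "norm \<alpha> ^ 2 = \<bar>real_of_int B\<bar>"
      using arg_cong[OF prod, of norm] \<open>norm \<beta> = norm \<alpha>\<close> by (simp add: norm_mult power2_eq_square)
    moreover have "\<bar>real_of_int B\<bar> \<le> t ^ 2"
    proof -
      have "real_of_int (A ^ 2) < real_of_int (4 * B)" using False by (simp add: D_def)
      then have "0 \<le> real_of_int B"
        by (smt (verit) of_int_0_le_iff of_int_less_iff zero_le_power2)
      then show ?thesis using AB(3) by simp
    qed
    ultimately have "norm \<alpha> \<le> t" using t by (metis power2_le_imp_le)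
    then show ?thesis using \<open>norm \<beta> = norm \<alpha>\<close> by simp
  qed
  \<comment> \<open>Which root is larger depends on the sign of \<open>A\<close>; as both are
    bounded by \<open>t\<close>, either order will do.\<close>
  moreover have "lucas_roots A B \<alpha> \<beta> \<or> lucas_roots A B \<beta> \<alpha>"
    unfolding lucas_roots_iff add.commute[of \<beta> \<alpha>] mult.commute[of \<beta> \<alpha>]
    using sum prod linear[of "norm \<alpha>" "norm \<beta>"] by blast
  ultimately show ?thesis by blast
qed

text \<open>The value \<open>k = 0\<close> contributes the points with \<open>B = A\<^sup>2 div 0 = 0\<close>.\<close>

definition degenerate_candidates :: "real \<Rightarrow> (int \<times> int) set" where
  "degenerate_candidates t =
     (\<lambda>(A, k). (A, A ^ 2 div k)) ` (({-\<lfloor>2 * t\<rfloor>..\<lfloor>2 * t\<rfloor>} - {0}) \<times> {0..4})"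

lemma root_triangle_diff_subset:
  assumes "0 \<le> t"
  shows "root_triangle t - degenerate_candidates t \<subseteq> lucas_pairs t"
proof clarify
  fix A B assume AB: "(A, B) \<in> root_triangle t" and nd: "(A, B) \<notin> degenerate_candidates t"
  have A: "A \<in> {-\<lfloor>2 * t\<rfloor>..\<lfloor>2 * t\<rfloor>} - {0}" using AB by (simp add: root_triangle_def)
  have k: "B \<noteq> A ^ 2 div k" if "k \<in> {0..4}" for k
    using nd A that unfolding degenerate_candidates_def by force
  have "B \<noteq> 0" using k[of 0] by simp
  obtain \<alpha> \<beta> where roots: "lucas_roots A B \<alpha> \<beta>" "norm \<alpha> \<le> t"
    using root_triangle_imp_lucas_roots[OF AB assms] by blast
  have "\<not> is_root_of_unity (\<alpha> / \<beta>)"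
  proof
    assume "is_root_of_unity (\<alpha> / \<beta>)"
    then obtain k' where k': "k' \<in> {0..4}" "A ^ 2 = k' * B"
      using degenerate_imp[OF roots(1) \<open>B \<noteq> 0\<close>] by blast
    \<comment> \<open>k' = 0 would force A = 0. For nonzero k' the division is exact, so
      \<open>B = A ^ 2 div k'\<close> is an excluded point.\<close>
    then have "k' \<noteq> 0" using A by auto
    then show False using k[OF k'(1)] k'(2) by simp
  qed
  then show "(A, B) \<in> lucas_pairs t"
    using roots A \<open>B \<noteq> 0\<close> by (auto simp: lucas_pairs_def nondegenerate_lucas_U_iff)
qed

section \<open>Counting lattice points\<close>

lemma sum_symmetric_int:
  fixes f :: "int \<Rightarrow> real"
  assumes "\<And>a. f (- a) = f a"
  shows "sum f ({-N..N} - {0}) = 2 * sum f {1..N}"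
proof -
  have "{-N..N} - {0} = uminus ` {1..N} \<union> {1..N}"
    by auto
  moreover have "uminus ` {1..N} \<inter> {1..N} = {}" by auto
  \<comment> \<open>The deleted rule would rewrite the image as an interval and hide the form that
    \<open>sum.reindex\<close> needs.\<close>
  ultimately show ?thesis
    by (simp add: sum.union_disjoint sum.reindex assms del: image_uminus_atLeastAtMost)
qed

lemma sum_affine_int:
  fixes c t :: real
  assumes "0 \<le> N"
  shows "(\<Sum>A = 1..N. c - of_int A * t) = of_int N * c - t * (of_int N * (of_int N + 1) / 2)"
  using assms
proof (induction N rule: int_ge_induct)
  case (step N)
  have "{1..N + 1} = insert (N + 1) {1..N}" using step.hyps by auto
  with step.IH show ?case by (simp add: field_simps)
qed simp

text \<open>Each column count differs from the column length 2t^2 - |A|t by at most 1. The lengths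
  add up to the area 4t^3, less 2t^2 for the missing column A = 0, plus a correction
  \<open>\<delta>\<close> in [0, t] from the fractional part of 2t.\<close>

lemma card_root_triangle:
  fixes t :: real
  assumes "0 \<le> t"
  shows "card (root_triangle t) \<le> 4 * t ^ 3 - 2 * t ^ 2 + 5 * t"
    and "4 * t ^ 3 - 2 * t ^ 2 - 4 * t \<le> card (root_triangle t)"
proof -
  define N where "N = \<lfloor>2 * t\<rfloor>"
  define \<theta> where "\<theta> = 2 * t - N"
  have N: "0 \<le> N" using assms by (simp add: N_def)
  have \<theta>: "0 \<le> \<theta>" "\<theta> \<le> 1" by (auto simp: \<theta>_def N_def) linarith+
  have Nt: "real_of_int N = 2 * t - \<theta>" by (simp add: \<theta>_def)
  define c where "c A = real (card {\<lceil>\<bar>A\<bar> * t - t ^ 2\<rceil>..\<lfloor>t ^ 2\<rfloor>})" for A :: int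
  have "real (card (root_triangle t)) = sum c ({-N..N} - {0})"
    unfolding root_triangle_def N_def [symmetric] c_def by (subst card_SigmaI) auto
  also have "\<dots> = 2 * sum c {1..N}"
    by (rule sum_symmetric_int) (simp add: c_def)
  finally have card: "real (card (root_triangle t)) = 2 * sum c {1..N}" .
  have c: "2 * t ^ 2 - 1 - A * t \<le> c A" "c A \<le> 2 * t ^ 2 + 1 - A * t" if "A \<in> {1..N}" for A
  proof -
    \<comment> \<open>This keeps the upper bound nonnegative, which settles the case of an empty
      column, where the maximum is 0.\<close>
    have "real_of_int A \<le> 2 * t" using that by (simp add: N_def le_floor_iff)
    then have "A * t \<le> 2 * t ^ 2"
      using mult_right_mono[of "real_of_int A" "2 * t" t] assms by (simp add: power2_eq_square)
    moreover have "c A = real_of_int (max 0 (\<lfloor>t ^ 2\<rfloor> + 1 - \<lceil>A * t - t ^ 2\<rceil>))"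
      using that by (simp add: c_def)
    ultimately show "2 * t ^ 2 - 1 - A * t \<le> c A" "c A \<le> 2 * t ^ 2 + 1 - A * t"
      by linarith+
  qed
  define \<delta> where "\<delta> = t * (\<theta> * (1 - \<theta>))"
  have "\<theta> * (1 - \<theta>) \<le> 1" using \<theta> by (intro mult_le_one) auto
  then have \<delta>: "0 \<le> \<delta>" "\<delta> \<le> t"
    using assms \<theta> by (simp_all add: \<delta>_def mult_left_le)
  \<comment> \<open>The values d = 1 and d = -1 are the extreme rounding errors per column.\<close>
  define \<sigma> where "\<sigma> d = (\<Sum>A = 1..N. 2 * t ^ 2 + d - A * t)" for d :: real
  have s: "2 * \<sigma> d = 4 * t ^ 3 - 2 * t ^ 2 + \<delta> + d * (4 * t - 2 * \<theta>)" for d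
    unfolding \<sigma>_def sum_affine_int[OF N] Nt \<delta>_def
    by (simp add: field_simps power2_eq_square power3_eq_cube)
  have "sum c {1..N} \<le> \<sigma> 1"
    unfolding \<sigma>_def using c by (intro sum_mono) auto
  moreover have "2 * \<sigma> 1 = 4 * t ^ 3 - 2 * t ^ 2 + \<delta> + 4 * t - 2 * \<theta>"
    using s[of 1] by simp
  ultimately show "card (root_triangle t) \<le> 4 * t ^ 3 - 2 * t ^ 2 + 5 * t"
    using card \<theta> \<delta> by linarith
  have "\<sigma> (-1) \<le> sum c {1..N}"
    unfolding \<sigma>_def using c by (intro sum_mono) auto
  moreover have "2 * \<sigma> (-1) = 4 * t ^ 3 - 2 * t ^ 2 + \<delta> - 4 * t + 2 * \<theta>"
    using s[of "-1"] by simp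
  ultimately show "4 * t ^ 3 - 2 * t ^ 2 - 4 * t \<le> card (root_triangle t)"
    using card \<theta> \<delta> by linarith
qed

lemma card_degenerate_candidates:
  fixes t :: real
  assumes "0 \<le> t"
  shows "card (degenerate_candidates t) \<le> 20 * t"
proof -
  define S where "S = {-\<lfloor>2 * t\<rfloor>..\<lfloor>2 * t\<rfloor>} - {0}"
  have "card (degenerate_candidates t) \<le> card (S \<times> {0..4::int})"
    unfolding degenerate_candidates_def S_def by (rule card_image_le) simp
  also have "\<dots> = 5 * card S" by (simp add: card_cartesian_product)
  finally have "real (card (degenerate_candidates t)) \<le> 5 * real (card S)" by linarith
  \<comment> \<open>The cardinality is the sum of the constant 1 over a symmetric set.\<close>
  moreover have "real (card S) = 2 * real_of_int \<lfloor>2 * t\<rfloor>"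
    using sum_symmetric_int[of "\<lambda>_. 1" "\<lfloor>2 * t\<rfloor>"] assms by (simp add: S_def)
  ultimately show ?thesis by linarith
qed

theorem theorem2p2:
  fixes t :: real
  assumes "t \<ge> 2"
  shows "4 * t ^ 3 - 10 * t ^ 2 - 29 * t \<le> real (M t) \<and>
         real (M t) \<le> 4 * t ^ 3 - t ^ 2 + 7 * t"
proof
  have t: "0 \<le> t" using assms by simp
  have fin: "finite (root_triangle t)" "finite (degenerate_candidates t)"
    by (auto simp: root_triangle_def degenerate_candidates_def)
  have "card (root_triangle t) - card (degenerate_candidates t)
      \<le> card (root_triangle t - degenerate_candidates t)"
    using fin by (intro diff_card_le_card_Diff)
  also have "\<dots> \<le> M t"
    unfolding M_def by (intro card_mono finite_lucas_pairs root_triangle_diff_subset t)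
  finally have "real (card (root_triangle t)) \<le> M t + real (card (degenerate_candidates t))"
    by linarith
  \<comment> \<open>The two counts give 4t^3 - 2t^2 - 4t - 20t, which exceeds the claimed bound by
    8t^2 + 5t.\<close>
  then show "4 * t ^ 3 - 10 * t ^ 2 - 29 * t \<le> real (M t)"
    using card_root_triangle(2)[OF t] card_degenerate_candidates[OF t] t zero_le_power2[of t]
    by linarith
  have "M t \<le> card (root_triangle t)"
    unfolding M_def by (intro card_mono fin lucas_pairs_subset)
  then show "real (M t) \<le> 4 * t ^ 3 - t ^ 2 + 7 * t"
    using card_root_triangle(1)[OF t] t zero_le_power2[of t] by linarith
qed

end
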